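(* Let $\mathbb{F}$ be a field, let $(\mathcal{V}, \langle \cdot , \cdot \rangle)$ be a pre-euclidean space over $\mathbb{F}$ with basis $\mathcal{B}=\{e_i\}_{i \in I}$, and let $f : \mathcal{V} \to \mathcal{V}$ be a linear operator. Then the following statements are equivalent. (i) The graph $\Gamma(f,\mathcal{B})$ associated to $f$ relative to $\mathcal{B}$ is connected. (ii) $\mathcal{V}$ is $f$-indecomposable with respect to $\mathcal{B}$.
   Context: Vector spaces are over an arbitrary field $\mathbb{F}$ and of arbitrary (possibly infinite) dimension. A pre-euclidean space is a pair $(\mathcal{V}, \langle\cdot,\cdot\rangle)$ where $\mathcal{V}$ is an $\mathbb{F}$-vector space and $\langle\cdot,\cdot\rangle:\mathcal{V}\times\mathcal{V}\to\mathbb{F}$ is a bilinear form (no symmetry or non-degeneracy is assumed). Orthogonal direct sum: $\mathcal{V} = U_1 \perp U_2$ means $\mathcal{V}=U_1\oplus U_2$ as a direct sum of linear subspaces with $\langle u_1,u_2\rangle = \langle u_2,u_1\rangle = 0$ for all $u_1\in U_1$, $u_2\in U_2$. Associated graph: $\Gamma(f,\mathcal{B})=(V,E)$ is the directed graph with vertex set $V=\mathcal{B}$ and with $(e_i,e_j)\in E$ if and only if $\langle e_i,e_j\rangle\neq 0$, or $\langle e_j,e_i\rangle\neq 0$, or the coefficient of $e_j$ in the expansion of $f(e_i)$ in the basis $\mathcal{B}$ is non-zero (loops are allowed). Connected: an undirected path from $v$ to $w$ is a finite sequence of vertices $(v_{1},\dots,v_{n})$ with $v_1=v$, $v_n=w$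 and, for each $1\le r\le n-1$, $(v_r,v_{r+1})\in E$ or $(v_{r+1},v_r)\in E$. Two vertices are connected if they are equal or there is an undirected path between them. The graph is connected if any two vertices are connected. A linear subspace $U$ of $\mathcal{V}$ admits a basis inherited from $\mathcal{B}$ if some subset $\mathcal{B}'\subset\mathcal{B}$ is a basis of $U$. $\mathcal{V}$ is $f$-decomposable with respect to $\mathcal{B}$ if $\mathcal{V}=U_1\perp U_2$ with $U_1,U_2$ non-zero linear subspaces, each admitting a basis inherited from $\mathcal{B}$, and $f(U_1)\subset U_1$, $f(U_2)\subset U_2$. Otherwise $\mathcal{V}$ is $f$-indecomposable with respect to $\mathcal{B}$. *)

theory Defs
  imports Complex_Main "Graph_Theory.Pair_Digraph"
begin

text \<open>
  An undirected path is a nonempty sequence of vertices, so it may have length one; arcs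
  may be traversed in either direction.
\<close>

definition undirected_path :: "'a pair_pre_digraph \<Rightarrow> 'a \<Rightarrow> 'a list \<Rightarrow> 'a \<Rightarrow> bool" where
  "undirected_path G v p w \<longleftrightarrow>
     p \<noteq> [] \<and> set p \<subseteq> pverts G \<and> hd p = v \<and> last p = w \<and>
     (\<forall>r. Suc r < length p \<longrightarrow>
        (p ! r, p ! Suc r) \<in> parcs G \<or> (p ! Suc r, p ! r) \<in> parcs G)"

text \<open>
  In contrast to the connectedness predicate of the Graph-Theory library, the empty graph is
  connected here. It occurs as the graph of the zero space.
\<close>

definition undirected_connected :: "'a pair_pre_digraph \<Rightarrow> bool" where
  "undirected_connected G \<longleftrightarrow>
     (\<forall>v\<in>pverts G. \<forall>w\<in>pverts G. v = w \<or> (\<exists>p. undirected_path G v p w))"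

definition (in vector_space) is_basis_of :: "'b set \<Rightarrow> 'b set \<Rightarrow> bool" where
  "is_basis_of B U \<longleftrightarrow> independent B \<and> span B = U"

definition (in vector_space) admits_inherited_basis :: "'b set \<Rightarrow> 'b set \<Rightarrow> bool" where
  "admits_inherited_basis B U \<longleftrightarrow> (\<exists>B'. B' \<subseteq> B \<and> is_basis_of B' U)"

text \<open>
  The vector space is the whole type. \<open>Vector_Spaces.linear\<close> is linearity over an arbitrary
  field; the unqualified name refers to real vector spaces.
\<close>

locale pre_euclidean_space = vector_space scale
  for scale :: "'k::field \<Rightarrow> 'v::ab_group_add \<Rightarrow> 'v" +
  fixes form :: "'v \<Rightarrow> 'v \<Rightarrow> 'k"
  assumes linear_form_right: "\<And>x. Vector_Spaces.linear scale (*) (\<lambda>y. form x y)"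
    and linear_form_left: "\<And>y. Vector_Spaces.linear scale (*) (\<lambda>x. form x y)"
begin

definition orthogonal_direct_sum :: "'v set \<Rightarrow> 'v set \<Rightarrow> bool" where
  "orthogonal_direct_sum U1 U2 \<longleftrightarrow>
     subspace U1 \<and> subspace U2 \<and>
     {u1 + u2 | u1 u2. u1 \<in> U1 \<and> u2 \<in> U2} = UNIV \<and> U1 \<inter> U2 = {0} \<and>
     (\<forall>u1\<in>U1. \<forall>u2\<in>U2. form u1 u2 = 0 \<and> form u2 u1 = 0)"

text \<open>\<open>representation B v b\<close> is the coefficient of \<open>b\<close> in the expansion of \<open>v\<close> in \<open>B\<close>.\<close>

definition associated_graph :: "('v \<Rightarrow> 'v) \<Rightarrow> 'v set \<Rightarrow> 'v pair_pre_digraph" where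
  "associated_graph f B =
     \<lparr> pverts = B,
       parcs = {(b, c). b \<in> B \<and> c \<in> B \<and>
         (form b c \<noteq> 0 \<or> form c b \<noteq> 0 \<or> representation B (f b) c \<noteq> 0)} \<rparr>"

definition decomposable :: "('v \<Rightarrow> 'v) \<Rightarrow> 'v set \<Rightarrow> bool" where
  "decomposable f B \<longleftrightarrow>
     (\<exists>U1 U2. orthogonal_direct_sum U1 U2 \<and> U1 \<noteq> {0} \<and> U2 \<noteq> {0} \<and>
        admits_inherited_basis B U1 \<and> admits_inherited_basis B U2 \<and>
        f ` U1 \<subseteq> U1 \<and> f ` U2 \<subseteq> U2)"

abbreviation indecomposable :: "('v \<Rightarrow> 'v) \<Rightarrow> 'v set \<Rightarrow> bool" where
  "indecomposable f B \<equiv> \<not> decomposable f B"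

end

end

theory Submission
  imports Defs
begin

text \<open>
  Connectedness fails exactly when some nonempty proper set of basis vectors has no arc to its
  complement. The spans of such a set and of its complement decompose the space, and conversely
  the inherited bases of two complementary summands partition the given basis in this way.
\<close>

text \<open>The equivalence excludes arcs leaving \<open>S\<close> as well as arcs entering it, so
  on the vertices \<open>S\<close> is a union of connected components.\<close>

definition arc_closed :: "'a pair_pre_digraph \<Rightarrow> 'a set \<Rightarrow> bool" where
  "arc_closed G S \<longleftrightarrow>
     (\<forall>v\<in>pverts G. \<forall>w\<in>pverts G. (v, w) \<in> parcs G \<longrightarrow> v \<in> S \<longleftrightarrow> w \<in> S)"

lemma undirected_path_arc_closed:
  assumes "undirected_path G v p w" "arc_closed G S" "v \<in> S"
  shows "w \<in> S"
proof -
  have p: "p \<noteq> []" "set p \<subseteq> pverts G" "hd p = v" "last p = w"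
    and arcs: "\<And>r. Suc r < length p \<Longrightarrow>
      (p ! r, p ! Suc r) \<in> parcs G \<or> (p ! Suc r, p ! r) \<in> parcs G"
    using assms(1) by (auto simp: undirected_path_def)
  have "p ! r \<in> S" if "r < length p" for r
    using that
  proof (induction r)
    case 0
    then show ?case using p assms(3) by (simp add: hd_conv_nth)
  next
    case (Suc r)
    then have "p ! r \<in> pverts G" "p ! Suc r \<in> pverts G"
      using p(2) by (auto dest: nth_mem)
    then show ?case
      using Suc arcs[of r] assms(2) by (auto simp: arc_closed_def)
  qed
  then show ?thesis
    using p by (metis last_conv_nth length_greater_0_conv diff_less zero_less_one)
qed

lemma undirected_path_snoc:
  assumes "undirected_path G v p w" "x \<in> pverts G" "(w, x) \<in> parcs G \<or> (x, w) \<in> parcs G"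
  shows "undirected_path G v (p @ [x]) x"
  \<comment> \<open>At the new last step \<open>Suc r = length p\<close>; the
    \<open>arg_cong\<close> rule turns this into \<open>r = length p - Suc 0\<close>, so that
    \<open>p ! r\<close> is \<open>last p\<close>.\<close>
  using assms
  by (auto simp: undirected_path_def nth_append last_conv_nth less_Suc_eq
      dest: arg_cong[where f = "\<lambda>n. n - Suc 0"])

lemma undirected_connected_iff_arc_closed:
  "undirected_connected G \<longleftrightarrow>
     (\<forall>S\<subseteq>pverts G. arc_closed G S \<longrightarrow> S = {} \<or> S = pverts G)"
proof (intro iffI allI impI)
  fix S
  assume "undirected_connected G" "S \<subseteq> pverts G" "arc_closed G S"
  then show "S = {} \<or> S = pverts G"
    by (fastforce simp: undirected_connected_def dest: undirected_path_arc_closed)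
next
  assume cut: "\<forall>S\<subseteq>pverts G. arc_closed G S \<longrightarrow> S = {} \<or> S = pverts G"
  have "\<exists>p. undirected_path G v p w" if "v \<in> pverts G" "w \<in> pverts G" for v w
  proof -
    \<comment> \<open>The component of \<open>v\<close>. It contains \<open>v\<close> because a
      one-vertex list is a path, and paths extend along arcs of either direction, so it is arc
      closed.\<close>
    define S where "S = {x \<in> pverts G. \<exists>p. undirected_path G v p x}"
    have "undirected_path G v [v] v"
      using that by (simp add: undirected_path_def)
    then have "v \<in> S"
      using that by (auto simp: S_def)
    moreover have "arc_closed G S"
      unfolding arc_closed_def S_def by (auto intro: undirected_path_snoc)
    moreover have "S \<subseteq> pverts G"
      by (auto simp: S_def)
    ultimately have "S = pverts G"
      using cut by blast
    then show ?thesis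
      using that by (auto simp: S_def)
  qed
  then show "undirected_connected G"
    by (simp add: undirected_connected_def)
qed

context vector_space
begin

text \<open>\<open>v\<close> is the finite sum of its terms with non-zero coefficient, and each of
  these lies in \<open>span S\<close>.\<close>

lemma mem_span_if_representation_support:
  assumes "independent B" "v \<in> span B" "\<And>b. representation B v b \<noteq> 0 \<Longrightarrow> b \<in> S"
  shows "v \<in> span S"
proof -
  have "(\<Sum>b | representation B v b \<noteq> 0. scale (representation B v b) b) \<in> span S"
    by (intro span_sum span_scale span_base) (simp add: assms(3))
  then show ?thesis
    using assms(1,2) by (simp add: sum_nonzero_representation_eq)
qed

text \<open>Coefficients are unique, so those of \<open>v\<close> relative to \<open>B\<close> are
  those relative to \<open>S\<close>, extended by zero.\<close>

lemma representation_support_of_span: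
  assumes "independent B" "S \<subseteq> B" "v \<in> span S" "representation B v b \<noteq> 0"
  shows "b \<in> S"
  using assms by (metis representation_extend representation_ne_zero)

lemma span_Int_span_of_disjoint:
  assumes "independent B" "S \<subseteq> B" "T \<subseteq> B" "S \<inter> T = {}"
  shows "span S \<inter> span T = {0}"
proof -
  have "v = 0" if v: "v \<in> span S" "v \<in> span T" for v
  proof -
    have "v \<in> span B"
      using v(1) span_mono[OF assms(2)] by blast
    \<comment> \<open>The support lies in both \<open>S\<close> and \<open>T\<close>; being empty,
      it places \<open>v\<close> in \<open>span {}\<close>.\<close>
    moreover have "b \<in> {}" if "representation B v b \<noteq> 0" for b
      using representation_support_of_span[OF assms(1,2) v(1) that]
        representation_support_of_span[OF assms(1,3) v(2) that] assms(4) by blast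
    ultimately have "v \<in> span {}"
      by (rule mem_span_if_representation_support[OF assms(1)])
    then show ?thesis by simp
  qed
  then show ?thesis
    by (auto simp: span_zero)
qed

text \<open>A vector of \<open>B\<close> outside \<open>S\<close> and \<open>T\<close> would lie in
  the span of the other vectors of \<open>B\<close>, against independence.\<close>

lemma inherited_bases_cover:
  assumes "independent B" "S \<subseteq> B" "T \<subseteq> B"
    and "{s + t |s t. s \<in> span S \<and> t \<in> span T} = UNIV"
  shows "S \<union> T = B"
proof -
  have "span (S \<union> T) = UNIV"
    using assms(4) by (simp add: span_Un)
  have "b \<in> S \<union> T" if "b \<in> B" for b
  proof (rule ccontr)
    assume "b \<notin> S \<union> T"
    then have "span (S \<union> T) \<subseteq> span (B - {b})"
      using assms(2,3) by (intro span_mono) auto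
    then show False
      using \<open>span (S \<union> T) = UNIV\<close> assms(1) that by (auto simp: dependent_def)
  qed
  then show ?thesis
    using assms(2,3) by blast
qed

end

context pre_euclidean_space
begin

lemma form_eq_0_on_spans:
  assumes "\<And>b c. b \<in> S \<Longrightarrow> c \<in> T \<Longrightarrow> form b c = 0" "x \<in> span S" "y \<in> span T"
  shows "form x y = 0"
proof -
  interpret left: Vector_Spaces.linear scale "(*)" "\<lambda>x. form x y"
    by (rule linear_form_left)
  have "form b y = 0" if "b \<in> S" for b
  proof -
    interpret right: Vector_Spaces.linear scale "(*)" "form b"
      by (rule linear_form_right)
    show ?thesis
      using assms(1)[OF that] assms(3) by (rule right.eq_0_on_span)
  qed
  then show ?thesis
    using assms(2) by (rule left.eq_0_on_span)
qed

text \<open>The summands are the spans of \<open>S\<close> and \<open>B - S\<close>. With no arcs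
  between the two sets, the form vanishes across them and \<open>f\<close> maps each basis vector
  into the span of its own side.\<close>

lemma decomposable_if_arc_closed:
  assumes basis: "is_basis_of B UNIV" and f: "Vector_Spaces.linear scale scale f"
    and S: "S \<subseteq> B" "S \<noteq> {}" "S \<noteq> B" "arc_closed (associated_graph f B) S"
  shows "decomposable f B"
proof -
  interpret f: Vector_Spaces.linear scale scale f by (rule f)
  define T where "T = B - S"
  have B: "independent B" "span B = UNIV"
    using basis by (auto simp: is_basis_of_def)
  have ST: "S \<union> T = B" "S \<inter> T = {}" "T \<subseteq> B" "T \<noteq> {}"
    using S by (auto simp: T_def)
  have indep: "independent S" "independent T"
    using independent_mono[OF B(1)] S(1) ST(3) by blast+
  have form: "form b c = 0" "form c b = 0" if "b \<in> S" "c \<in> T" for b c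
    using that S(1,4) by (auto simp: T_def arc_closed_def associated_graph_def)
  \<comment> \<open>\<open>b\<close> and \<open>c\<close> lie on opposite sides, in either order;
    both orders are needed for the invariance of both spans.\<close>
  have rep: "representation B (f b) c = 0"
    if "b \<in> B" "c \<in> B" "b \<in> S \<longleftrightarrow> c \<notin> S" for b c
    using that S(4) by (auto simp: arc_closed_def associated_graph_def)
  have f_basis: "f b \<in> span R" if "b \<in> R" "R = S \<or> R = T" for b R
  proof (rule mem_span_if_representation_support[OF B(1)])
    show "f b \<in> span B" by (simp add: B(2))
    show "c \<in> R" if "representation B (f b) c \<noteq> 0" for c
      using that rep[of b c] \<open>b \<in> R\<close> \<open>R = S \<or> R = T\<close> S(1)
        representation_ne_zero[OF that] by (auto simp: T_def)
  qed
  have invariant: "f ` span R \<subseteq> span R" if "R = S \<or> R = T" for R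
  proof -
    have "span (f ` R) \<subseteq> span R"
      using f_basis that by (intro span_minimal) auto
    then show ?thesis by (simp add: f.span_image)
  qed
  \<comment> \<open>An independent set does not contain \<open>0\<close>, so any element of
    \<open>R\<close> is a non-zero vector of the span.\<close>
  have nonzero: "span R \<noteq> {0}" if "independent R" "R \<noteq> {}" for R
    using that dependent_zero span_superset[of R] by auto
  have "orthogonal_direct_sum (span S) (span T)"
    unfolding orthogonal_direct_sum_def
  proof (intro conjI ballI)
    show "{u1 + u2 |u1 u2. u1 \<in> span S \<and> u2 \<in> span T} = UNIV"
      using B(2) ST(1) span_Un[of S T] by simp
    show "span S \<inter> span T = {0}"
      by (rule span_Int_span_of_disjoint[OF B(1) S(1) ST(3,2)])
    show "form x y = 0" "form y x = 0" if "x \<in> span S" "y \<in> span T" for x y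
      using that form by (blast intro: form_eq_0_on_spans)+
  qed simp_all
  moreover have "admits_inherited_basis B (span S)" "admits_inherited_basis B (span T)"
    using indep S(1) ST(3) by (auto simp: admits_inherited_basis_def is_basis_of_def)
  ultimately show ?thesis
    unfolding decomposable_def
    using nonzero[OF indep(1) S(2)] nonzero[OF indep(2) ST(4)] invariant[of S] invariant[of T]
    by (intro exI[of _ "span S"] exI[of _ "span T"]) simp
qed

text \<open>The inherited bases of the two summands partition \<open>B\<close>. Orthogonality and
  invariance then rule out each of the three causes of an arc between them.\<close>

lemma arc_closed_if_decomposable:
  assumes basis: "is_basis_of B UNIV" and "decomposable f B"
  obtains S where "S \<subseteq> B" "S \<noteq> {}" "S \<noteq> B" "arc_closed (associated_graph f B) S"
proof -
  have B: "independent B"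
    using basis by (auto simp: is_basis_of_def)
  obtain S T where sum: "orthogonal_direct_sum (span S) (span T)"
    and nz: "span S \<noteq> {0}" "span T \<noteq> {0}" and sub: "S \<subseteq> B" "T \<subseteq> B"
    and inv: "f ` span S \<subseteq> span S" "f ` span T \<subseteq> span T"
    using assms(2)
    by (auto simp: decomposable_def admits_inherited_basis_def is_basis_of_def)
  have cover: "S \<union> T = B"
    using sum sub B by (intro inherited_bases_cover) (auto simp: orthogonal_direct_sum_def)
  have disjoint: "S \<inter> T = {}"
  proof -
    have "S \<inter> T \<subseteq> span S \<inter> span T"
      by (auto intro: span_base)
    also have "\<dots> = {0}"
      using sum by (simp add: orthogonal_direct_sum_def)
    finally have "S \<inter> T \<subseteq> {0}" .
    moreover have "0 \<notin> S"
      using B sub(1) dependent_zero by blast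
    ultimately show ?thesis by blast
  qed
  have form: "form b c = 0" "form c b = 0" if "b \<in> S" "c \<in> T" for b c
    using that sum by (auto simp: orthogonal_direct_sum_def span_base)
  have rep: "c \<in> R"
    if "representation B (f b) c \<noteq> 0" "b \<in> R" "R = S \<or> R = T" for b c R
  proof (rule representation_support_of_span[OF B _ _ that(1)])
    show "R \<subseteq> B" using that(3) sub by auto
    show "f b \<in> span R" using that(2,3) inv span_base by blast
  qed
  have "b \<in> S \<longleftrightarrow> c \<in> S"
    if "b \<in> B" "c \<in> B" "form b c \<noteq> 0 \<or> form c b \<noteq> 0 \<or> representation B (f b) c \<noteq> 0" for b c
    using that form[of b c] form[of c b] rep[of b c S] rep[of b c T] cover disjoint by blast
  then have "arc_closed (associated_graph f B) S"
    by (auto simp: arc_closed_def associated_graph_def)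
  \<comment> \<open>Since \<open>span {} = {0}\<close>, both parts are non-empty; \<open>T\<close>
    being non-empty and disjoint from \<open>S\<close> makes \<open>S\<close> proper.\<close>
  moreover have "S \<noteq> {}" "T \<noteq> {}"
    using nz by auto
  ultimately show thesis
    using that[of S] sub cover disjoint by blast
qed

end

theorem theorem3p1:
  fixes scale :: "'k::field \<Rightarrow> 'v::ab_group_add \<Rightarrow> 'v"
    and form :: "'v \<Rightarrow> 'v \<Rightarrow> 'k"
    and f :: "'v \<Rightarrow> 'v"
    and B :: "'v set"
  assumes "pre_euclidean_space scale form"
    and "vector_space.is_basis_of scale B UNIV"
    and "Vector_Spaces.linear scale scale f"
  shows "undirected_connected (pre_euclidean_space.associated_graph scale form f B) \<longleftrightarrow>
         pre_euclidean_space.indecomposable scale form f B"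
proof -
  interpret pre_euclidean_space scale form by (rule assms(1))
  have "pverts (associated_graph f B) = B"
    by (simp add: associated_graph_def)
  then show ?thesis
    \<comment> \<open>Both sides now deny the existence of a non-empty proper arc-closed subset of
      \<open>B\<close>, one directly and one through the two preceding lemmas.\<close>
    unfolding undirected_connected_iff_arc_closed
    using decomposable_if_arc_closed[OF assms(2,3)] arc_closed_if_decomposable[OF assms(2)]
    by metis
qed

end
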